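(* Let $G$ be a first-order structure expanding a group, $T$ its complete theory, and $\mathbb{G}$ a sufficiently saturated monster model of $T$. Let $\varphi(x)$ be a formula in one variable with parameters from $G$. The following are equivalent: (i) $\varphi(G)$ has the $1$-sided productset property; (ii) $\varphi(x)$ is $1$-sided coheir substantial, i.e. there are $b,c\in\mathbb{G}\setminus G$ such that $\mathbb{G}\models\varphi(b\cdot c)$ and $\mathrm{tp}(b/Gc)$ is finitely satisfiable in $G$; (iii) there are nonalgebraic global types $p,q\in S_1(\mathbb{G})$ such that $p$ is finitely satisfiable in $G$ and $\varphi(x\cdot y)\in p(x)\otimes q(y)$.
   Context: A set $A\subseteq G$ has the $1$-sided productset property if there are infinite sequences $(b_i)_{i<\omega}$ and $(c_i)_{i<\omega}$ in $G$ (each of pairwise distinct elements) such that $b_i\cdot c_j\in A$ for all $i\leq j<\omega$. A type is finitely satisfiable in $G$ if each of its formulas is satisfied in $G$; a global type (type over $\mathbb{G}$) is nonalgebraic if it is not realized in $\mathbb{G}$. For global types $p,q$ with $p$ invariant over a small set $A$ (e.g. $p$ finitely satisfiable in $G$, hence $G$-invariant), $p(x)\otimes q(y)$ is the global type such that for a small $B\supseteq A$ and a formula $\theta(x,y)$ over $B$, $\theta(x,y)\in p(x)\otimes q(y)$ iff $\theta(x,c)\in p$ for some (any) $c$ realizing $q|_B$. *)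

theory Defs
  imports Main "HOL-Algebra.Group"
begin

unbundle cardinal_syntax

text \<open>Symbols of a language are the elements of \<open>'f\<close> and \<open>'r\<close> to which an arity is assigned.\<close>

record ('f, 'r) lang =
  fun_arity :: "'f \<Rightarrow> nat option"
  rel_arity :: "'r \<Rightarrow> nat option"

text \<open>
  Formulas with parameters: \<open>Par a\<close> is the constant naming the element \<open>a\<close>.  Variables are
  de Bruijn indices, so \<open>Exists\<close> binds index 0 and shifts the free variables of its scope by one.
\<close>

datatype (dead 'f, tpars: 'a) tm = Var nat | Par 'a | App 'f "('f, 'a) tm list"

datatype (dead 'f, dead 'r, fpars: 'a) fm =
    Eq "('f, 'a) tm" "('f, 'a) tm"
  | Rel 'r "('f, 'a) tm list"
  | Neg "('f, 'r, 'a) fm"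
  | And "('f, 'r, 'a) fm" "('f, 'r, 'a) fm"
  | Exists "('f, 'r, 'a) fm"

primrec tvars :: "('f, 'a) tm \<Rightarrow> nat set" where
  "tvars (Var n) = {n}"
| "tvars (Par a) = {}"
| "tvars (App f ts) = \<Union> (set (map tvars ts))"

primrec fvars :: "('f, 'r, 'a) fm \<Rightarrow> nat set" where
  "fvars (Eq s t) = tvars s \<union> tvars t"
| "fvars (Rel r ts) = \<Union> (set (map tvars ts))"
| "fvars (Neg \<phi>) = fvars \<phi>"
| "fvars (And \<phi> \<psi>) = fvars \<phi> \<union> fvars \<psi>"
| "fvars (Exists \<phi>) = {n. Suc n \<in> fvars \<phi>}"

primrec wf_tm :: "('f, 'r) lang \<Rightarrow> ('f, 'a) tm \<Rightarrow> bool" where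
  "wf_tm L (Var n) \<longleftrightarrow> True"
| "wf_tm L (Par a) \<longleftrightarrow> True"
| "wf_tm L (App f ts) \<longleftrightarrow> fun_arity L f = Some (length ts) \<and> list_all (wf_tm L) ts"

primrec wf_fm :: "('f, 'r) lang \<Rightarrow> ('f, 'r, 'a) fm \<Rightarrow> bool" where
  "wf_fm L (Eq s t) \<longleftrightarrow> wf_tm L s \<and> wf_tm L t"
| "wf_fm L (Rel r ts) \<longleftrightarrow> rel_arity L r = Some (length ts) \<and> list_all (wf_tm L) ts"
| "wf_fm L (Neg \<phi>) \<longleftrightarrow> wf_fm L \<phi>"
| "wf_fm L (And \<phi> \<psi>) \<longleftrightarrow> wf_fm L \<phi> \<and> wf_fm L \<psi>"
| "wf_fm L (Exists \<phi>) \<longleftrightarrow> wf_fm L \<phi>"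

text \<open>The \<open>L\<close>-formulas with parameters in \<open>A\<close> and free variables among the first \<open>n\<close>.\<close>

definition fml :: "('f, 'r) lang \<Rightarrow> 'a set \<Rightarrow> nat \<Rightarrow> ('f, 'r, 'a) fm set" where
  "fml L A n = {\<phi>. wf_fm L \<phi> \<and> fpars \<phi> \<subseteq> A \<and> fvars \<phi> \<subseteq> {..<n}}"

primrec tsubst :: "(nat \<Rightarrow> ('f, 'a) tm) \<Rightarrow> ('f, 'a) tm \<Rightarrow> ('f, 'a) tm" where
  "tsubst \<sigma> (Var n) = \<sigma> n"
| "tsubst \<sigma> (Par a) = Par a"
| "tsubst \<sigma> (App f ts) = App f (map (tsubst \<sigma>) ts)"

primrec fsubst :: "(nat \<Rightarrow> ('f, 'a) tm) \<Rightarrow> ('f, 'r, 'a) fm \<Rightarrow> ('f, 'r, 'a) fm" where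
  "fsubst \<sigma> (Eq s t) = Eq (tsubst \<sigma> s) (tsubst \<sigma> t)"
| "fsubst \<sigma> (Rel r ts) = Rel r (map (tsubst \<sigma>) ts)"
| "fsubst \<sigma> (Neg \<phi>) = Neg (fsubst \<sigma> \<phi>)"
| "fsubst \<sigma> (And \<phi> \<psi>) = And (fsubst \<sigma> \<phi>) (fsubst \<sigma> \<psi>)"
| "fsubst \<sigma> (Exists \<phi>) = Exists (fsubst (case_nat (Var 0) (\<lambda>n. tsubst (\<lambda>k. Var (Suc k)) (\<sigma> n))) \<phi>)"

record ('f, 'r, 'a) fo_struct =
  universe :: "'a set"
  fun_int :: "'f \<Rightarrow> 'a list \<Rightarrow> 'a"
  rel_int :: "'r \<Rightarrow> 'a list set"

definition is_struct :: "('f, 'r) lang \<Rightarrow> ('f, 'r, 'a) fo_struct \<Rightarrow> bool" where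
  "is_struct L M \<longleftrightarrow> universe M \<noteq> {} \<and>
     (\<forall>f as. fun_arity L f = Some (length as) \<and> set as \<subseteq> universe M \<longrightarrow> fun_int M f as \<in> universe M)"

primrec tval :: "('f, 'r, 'a) fo_struct \<Rightarrow> (nat \<Rightarrow> 'a) \<Rightarrow> ('f, 'a) tm \<Rightarrow> 'a" where
  "tval M e (Var n) = e n"
| "tval M e (Par a) = a"
| "tval M e (App f ts) = fun_int M f (map (tval M e) ts)"

primrec sat :: "('f, 'r, 'a) fo_struct \<Rightarrow> (nat \<Rightarrow> 'a) \<Rightarrow> ('f, 'r, 'a) fm \<Rightarrow> bool" where
  "sat M e (Eq s t) \<longleftrightarrow> tval M e s = tval M e t"
| "sat M e (Rel r ts) \<longleftrightarrow> map (tval M e) ts \<in> rel_int M r"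
| "sat M e (Neg \<phi>) \<longleftrightarrow> \<not> sat M e \<phi>"
| "sat M e (And \<phi> \<psi>) \<longleftrightarrow> sat M e \<phi> \<and> sat M e \<psi>"
| "sat M e (Exists \<phi>) \<longleftrightarrow> (\<exists>a\<in>universe M. sat M (case_nat a e) \<phi>)"

text \<open>Satisfaction of a formula in one free variable (index 0).\<close>

definition holds :: "('f, 'r, 'a) fo_struct \<Rightarrow> ('f, 'r, 'a) fm \<Rightarrow> 'a \<Rightarrow> bool" where
  "holds M \<phi> a \<longleftrightarrow> sat M (\<lambda>_. a) \<phi>"

definition defset :: "('f, 'r, 'a) fo_struct \<Rightarrow> ('f, 'r, 'a) fm \<Rightarrow> 'a set" where
  "defset M \<phi> = {a \<in> universe M. holds M \<phi> a}"

definition elem_ext :: "('f, 'r) lang \<Rightarrow> ('f, 'r, 'a) fo_struct \<Rightarrow> ('f, 'r, 'a) fo_struct \<Rightarrow> bool" where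
  "elem_ext L G M \<longleftrightarrow> is_struct L G \<and> is_struct L M \<and> universe G \<subseteq> universe M \<and>
     (\<forall>f as. fun_arity L f = Some (length as) \<and> set as \<subseteq> universe G \<longrightarrow> fun_int G f as = fun_int M f as) \<and>
     (\<forall>n. \<forall>\<phi>\<in>fml L (universe G) n. \<forall>e. range e \<subseteq> universe G \<longrightarrow> (sat G e \<phi> \<longleftrightarrow> sat M e \<phi>))"

text \<open>
  Complete 1-types over \<open>A\<close> in \<open>M\<close>.  Consistency with the theory of \<open>M\<close> (with parameters) means
  that every finite part is realized in \<open>M\<close>.
\<close>

definition S1 :: "('f, 'r) lang \<Rightarrow> ('f, 'r, 'a) fo_struct \<Rightarrow> 'a set \<Rightarrow> ('f, 'r, 'a) fm set set" where
  "S1 L M A = {p. p \<subseteq> fml L A 1 \<and>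
     (\<forall>\<Delta>. finite \<Delta> \<and> \<Delta> \<subseteq> p \<longrightarrow> (\<exists>a\<in>universe M. \<forall>\<phi>\<in>\<Delta>. holds M \<phi> a)) \<and>
     (\<forall>\<phi>\<in>fml L A 1. \<phi> \<in> p \<or> Neg \<phi> \<in> p)}"

definition tp :: "('f, 'r) lang \<Rightarrow> ('f, 'r, 'a) fo_struct \<Rightarrow> 'a \<Rightarrow> 'a set \<Rightarrow> ('f, 'r, 'a) fm set" where
  "tp L M b A = {\<phi> \<in> fml L A 1. holds M \<phi> b}"

definition realizes :: "('f, 'r, 'a) fo_struct \<Rightarrow> 'a \<Rightarrow> ('f, 'r, 'a) fm set \<Rightarrow> bool" where
  "realizes M b p \<longleftrightarrow> b \<in> universe M \<and> (\<forall>\<phi>\<in>p. holds M \<phi> b)"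

definition nonalgebraic :: "('f, 'r, 'a) fo_struct \<Rightarrow> ('f, 'r, 'a) fm set \<Rightarrow> bool" where
  "nonalgebraic M p \<longleftrightarrow> (\<nexists>b. realizes M b p)"

definition finsat_in :: "('f, 'r, 'a) fo_struct \<Rightarrow> ('f, 'r, 'a) fm set \<Rightarrow> 'a set \<Rightarrow> bool" where
  "finsat_in M p A \<longleftrightarrow> (\<forall>\<phi>\<in>p. \<exists>a\<in>A. holds M \<phi> a)"

text \<open>
  A monster model over \<open>G\<close>: an elementary extension that is \<open>\<kappa>\<close>-saturated for some infinite
  cardinal \<open>\<kappa>\<close> exceeding the size of \<open>G\<close>; a set is small if it has size less than \<open>\<kappa>\<close>.
  Strong homogeneity and a bound on the size of the language are not imposed.
\<close>

definition saturated :: "('f, 'r) lang \<Rightarrow> 'k rel \<Rightarrow> ('f, 'r, 'a) fo_struct \<Rightarrow> bool" where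
  "saturated L \<kappa> M \<longleftrightarrow>
     (\<forall>A \<subseteq> universe M. |A| <o \<kappa> \<longrightarrow> (\<forall>p\<in>S1 L M A. \<exists>b. realizes M b p))"

definition monster :: "('f, 'r) lang \<Rightarrow> 'k rel \<Rightarrow> ('f, 'r, 'a) fo_struct \<Rightarrow> ('f, 'r, 'a) fo_struct \<Rightarrow> bool" where
  "monster L \<kappa> G M \<longleftrightarrow> Card_order \<kappa> \<and> infinite (Field \<kappa>) \<and> |universe G| <o \<kappa> \<and>
     elem_ext L G M \<and> saturated L \<kappa> M"

text \<open>
  The product of a global type \<open>p\<close>, invariant over the small set \<open>A\<close>, with a global type \<open>q\<close>.
  In \<open>\<theta>(x,y)\<close> the variable \<open>x\<close> has index 0 and \<open>y\<close> has index 1.  By invariance the choice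
  of \<open>B\<close> and of the realization \<open>c\<close> is irrelevant; see \<open>tensor_iff_any\<close> below.
\<close>

definition tensor :: "('f, 'r) lang \<Rightarrow> 'k rel \<Rightarrow> ('f, 'r, 'a) fo_struct \<Rightarrow> 'a set \<Rightarrow>
    ('f, 'r, 'a) fm set \<Rightarrow> ('f, 'r, 'a) fm set \<Rightarrow> ('f, 'r, 'a) fm set" where
  "tensor L \<kappa> M A p q = {\<theta>. \<exists>B c. A \<subseteq> B \<and> B \<subseteq> universe M \<and> |B| <o \<kappa> \<and> \<theta> \<in> fml L B 2 \<and>
     realizes M c (q \<inter> fml L B 1) \<and> fsubst (Var(1 := Par c)) \<theta> \<in> p}"

text \<open>\<open>G\<close> expands the group \<open>H\<close>, the function symbol \<open>m\<close> denoting the multiplication.\<close>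

definition expands_group ::
    "('f, 'r) lang \<Rightarrow> ('f, 'r, 'a) fo_struct \<Rightarrow> 'f \<Rightarrow> ('a, 'b) monoid_scheme \<Rightarrow> bool" where
  "expands_group L G m H \<longleftrightarrow> is_struct L G \<and> group H \<and> carrier H = universe G \<and>
     fun_arity L m = Some 2 \<and> (\<forall>x\<in>universe G. \<forall>y\<in>universe G. fun_int G m [x, y] = x \<otimes>\<^bsub>H\<^esub> y)"

definition one_sided_productset :: "('a, 'b) monoid_scheme \<Rightarrow> 'a set \<Rightarrow> bool" where
  "one_sided_productset H A \<longleftrightarrow>
     (\<exists>b c :: nat \<Rightarrow> 'a. inj b \<and> inj c \<and> range b \<subseteq> carrier H \<and> range c \<subseteq> carrier H \<and>
        (\<forall>i j. i \<le> j \<longrightarrow> b i \<otimes>\<^bsub>H\<^esub> c j \<in> A))"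

definition coheir_substantial ::
    "('f, 'r) lang \<Rightarrow> ('f, 'r, 'a) fo_struct \<Rightarrow> ('f, 'r, 'a) fo_struct \<Rightarrow> 'f \<Rightarrow> ('f, 'r, 'a) fm \<Rightarrow> bool" where
  "coheir_substantial L G M m \<phi> \<longleftrightarrow>
     (\<exists>b \<in> universe M - universe G. \<exists>c \<in> universe M - universe G.
        holds M \<phi> (fun_int M m [b, c]) \<and> finsat_in M (tp L M b (insert c (universe G))) (universe G))"

lemma tval_tsubst: "tval M e (tsubst \<sigma> t) = tval M (\<lambda>n. tval M e (\<sigma> n)) t"
  by (induction t) (auto cong: map_cong simp: comp_def)

lemma sat_fsubst: "sat M e (fsubst \<sigma> \<phi>) \<longleftrightarrow> sat M (\<lambda>n. tval M e (\<sigma> n)) \<phi>"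
proof (induction \<phi> arbitrary: e \<sigma>)
  case (Exists \<phi>)
  have "(\<lambda>n. tval M (case_nat a e) (case_nat (Var 0) (\<lambda>n. tsubst (\<lambda>k. Var (Suc k)) (\<sigma> n)) n)) =
      case_nat a (\<lambda>n. tval M e (\<sigma> n))" for a
    by (auto simp: fun_eq_iff tval_tsubst split: nat.split)
  then show ?case by (simp add: Exists.IH)
qed (auto simp: tval_tsubst comp_def)

lemma tval_cong: "(\<And>n. n \<in> tvars t \<Longrightarrow> e n = e' n) \<Longrightarrow> tval M e t = tval M e' t"
proof (induction t)
  case (App f ts)
  then have "map (tval M e) ts = map (tval M e') ts" by fastforce
  then show ?case by (simp only: tval.simps)
qed auto

lemma sat_cong: "(\<And>n. n \<in> fvars \<phi> \<Longrightarrow> e n = e' n) \<Longrightarrow> sat M e \<phi> = sat M e' \<phi>"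
proof (induction \<phi> arbitrary: e e')
  case (Eq s t)
  then have "tval M e s = tval M e' s" "tval M e t = tval M e' t" by (auto intro: tval_cong)
  then show ?case by simp
next
  case (Rel r ts)
  then have "map (tval M e) ts = map (tval M e') ts" by (auto intro!: tval_cong)
  then show ?case by (simp only: sat.simps)
next
  case (Neg \<phi>)
  have "sat M e \<phi> = sat M e' \<phi>" by (rule Neg.IH) (simp add: Neg.prems)
  then show ?case by simp
next
  case (And \<phi> \<psi>)
  have "sat M e \<phi> = sat M e' \<phi>" "sat M e \<psi> = sat M e' \<psi>"
    by (rule And.IH; simp add: And.prems)+
  then show ?case by simp
next
  case (Exists \<phi>)
  have "sat M (case_nat a e) \<phi> = sat M (case_nat a e') \<phi>" for a
    by (rule Exists.IH) (auto simp: Exists.prems split: nat.split)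
  then show ?case by simp
qed

lemma tvars_tsubst: "tvars (tsubst \<sigma> t) = (\<Union>n\<in>tvars t. tvars (\<sigma> n))"
  by (induction t) auto

lemma fvars_fsubst: "fvars (fsubst \<sigma> \<phi>) = (\<Union>n\<in>fvars \<phi>. tvars (\<sigma> n))"
proof (induction \<phi> arbitrary: \<sigma>)
  case (Exists \<phi>)
  show ?case
  proof (rule Set.set_eqI)
    fix k
    let ?s = "case_nat (Var 0) (\<lambda>n. tsubst (\<lambda>k. Var (Suc k)) (\<sigma> n))"
    have *: "Suc k \<in> tvars (?s n) \<longleftrightarrow> (\<exists>n'. n = Suc n' \<and> k \<in> tvars (\<sigma> n'))" for n
      by (cases n) (auto simp: tvars_tsubst)
    have "k \<in> fvars (fsubst \<sigma> (Exists \<phi>)) \<longleftrightarrow> (\<exists>n\<in>fvars \<phi>. Suc k \<in> tvars (?s n))"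
      by (simp add: Exists.IH)
    also have "\<dots> \<longleftrightarrow> (\<exists>n'. Suc n' \<in> fvars \<phi> \<and> k \<in> tvars (\<sigma> n'))"
      unfolding * by blast
    finally show "k \<in> fvars (fsubst \<sigma> (Exists \<phi>)) \<longleftrightarrow> k \<in> (\<Union>n\<in>fvars (Exists \<phi>). tvars (\<sigma> n))"
      by simp
  qed
qed (simp_all add: tvars_tsubst)

lemma tpars_tsubst: "tpars (tsubst \<sigma> t) \<subseteq> tpars t \<union> (\<Union>n. tpars (\<sigma> n))"
  by (induction t) fastforce+

lemma fpars_fsubst: "fpars (fsubst \<sigma> \<phi>) \<subseteq> fpars \<phi> \<union> (\<Union>n. tpars (\<sigma> n))"
proof (induction \<phi> arbitrary: \<sigma>)
  case (Eq s t)
  then show ?case using tpars_tsubst[of \<sigma> s] tpars_tsubst[of \<sigma> t] by auto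
next
  case (Rel r ts)
  then show ?case using tpars_tsubst[of \<sigma>] by fastforce
next
  case (Neg \<phi>)
  then show ?case by simp
next
  case (And \<phi> \<psi>)
  show ?case using And.IH(1)[of \<sigma>] And.IH(2)[of \<sigma>] by auto
next
  case (Exists \<phi>)
  let ?s = "case_nat (Var 0) (\<lambda>n. tsubst (\<lambda>k. Var (Suc k)) (\<sigma> n))"
  have "tpars (?s n) \<subseteq> (\<Union>n. tpars (\<sigma> n))" for n
  proof (cases n)
    case (Suc k)
    then show ?thesis using tpars_tsubst[of "\<lambda>k. Var (Suc k)" "\<sigma> k"] by auto
  qed simp
  then have "(\<Union>n. tpars (?s n)) \<subseteq> (\<Union>n. tpars (\<sigma> n))" by (rule UN_least)
  with Exists.IH[of ?s] show ?case unfolding fsubst.simps fm.set by (meson Un_mono order_refl order_trans)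
qed

lemma wf_tsubst: "wf_tm L t \<Longrightarrow> (\<And>n. wf_tm L (\<sigma> n)) \<Longrightarrow> wf_tm L (tsubst \<sigma> t)"
  by (induction t) (auto simp: list_all_iff)

lemma wf_fsubst: "wf_fm L \<phi> \<Longrightarrow> (\<And>n. wf_tm L (\<sigma> n)) \<Longrightarrow> wf_fm L (fsubst \<sigma> \<phi>)"
  by (induction \<phi> arbitrary: \<sigma>) (auto simp: list_all_iff wf_tsubst split: nat.split)

lemma tensor_iff_any:
  fixes M :: "('f, 'r, 'a) fo_struct"
  assumes p: "p \<in> S1 L M (universe M)" "finsat_in M p A" and q: "q \<in> S1 L M (universe M)"
    and B: "A \<subseteq> B" "B \<subseteq> universe M" "|B| <o \<kappa>" "\<theta> \<in> fml L B 2"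
    and c: "realizes M c (q \<inter> fml L B 1)"
  shows "\<theta> \<in> tensor L \<kappa> M A p q \<longleftrightarrow> fsubst (Var(1 := Par c)) \<theta> \<in> p"
proof
  assume "fsubst (Var(1 := Par c)) \<theta> \<in> p"
  then show "\<theta> \<in> tensor L \<kappa> M A p q" unfolding tensor_def using B c by blast
next
  let ?i = "\<lambda>c. fsubst (Var(1 := Par c)) \<theta>"
  assume "\<theta> \<in> tensor L \<kappa> M A p q"
  then obtain B' c' where B': "A \<subseteq> B'" "B' \<subseteq> universe M" "\<theta> \<in> fml L B' 2"
    and c': "realizes M c' (q \<inter> fml L B' 1)" and p': "?i c' \<in> p"
    unfolding tensor_def by blast
  have vars: "fvars \<theta> \<subseteq> {0, 1}" and pars: "fpars \<theta> \<subseteq> B \<inter> B'" and wf: "wf_fm L \<theta>"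
    using B B' by (auto simp: fml_def)
  have sat_i: "holds M (?i d) a \<longleftrightarrow> sat M (case_nat a (\<lambda>_. d)) \<theta>" for d a
    unfolding holds_def sat_fsubst by (rule sat_cong) (use vars in auto)
  have fml_i: "?i c \<in> fml L (universe M) 1"
  proof -
    have "c \<in> universe M" using c by (simp add: realizes_def)
    then have "fpars (?i c) \<subseteq> universe M"
      using fpars_fsubst[of "Var(1 := Par c)" \<theta>] pars B(2)
      by (fastforce split: if_splits)
    moreover have "wf_fm L (?i c)" by (rule wf_fsubst[OF wf]) simp
    moreover have "fvars (?i c) \<subseteq> {..<1}"
      using vars by (auto simp: fvars_fsubst split: if_splits)
    ultimately show ?thesis by (simp add: fml_def)
  qed
  show "?i c \<in> p"
  proof (rule ccontr)
    assume "?i c \<notin> p"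
    then have n: "Neg (?i c) \<in> p" using fml_i p(1) by (auto simp: S1_def)
    let ?\<psi> = "And (?i c') (Neg (?i c))"
    have "?i c' \<in> fml L (universe M) 1" using p' p(1) by (auto simp: S1_def)
    with fml_i have "?\<psi> \<in> fml L (universe M) 1" by (simp add: fml_def)
    moreover have "Neg ?\<psi> \<notin> p"
    proof
      assume "Neg ?\<psi> \<in> p"
      then have "finite {Neg ?\<psi>, ?i c', Neg (?i c)} \<and> {Neg ?\<psi>, ?i c', Neg (?i c)} \<subseteq> p"
        using n p' by simp
      then have "\<exists>a\<in>universe M. \<forall>\<phi>\<in>{Neg ?\<psi>, ?i c', Neg (?i c)}. holds M \<phi> a"
        using p(1) unfolding S1_def by blast
      then show False by (auto simp: holds_def)
    qed
    ultimately have "?\<psi> \<in> p" using p(1) by (auto simp: S1_def)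
    then obtain a where a: "a \<in> A" "holds M ?\<psi> a" using p(2) by (auto simp: finsat_in_def)
    then have s: "sat M (case_nat a (\<lambda>_. c')) \<theta>" "\<not> sat M (case_nat a (\<lambda>_. c)) \<theta>"
      using sat_i by (auto simp: holds_def)
    let ?\<chi> = "fsubst (case_nat (Par a) Var) \<theta>"
    have holds_\<chi>: "holds M ?\<chi> d \<longleftrightarrow> sat M (case_nat a (\<lambda>_. d)) \<theta>" for d
      unfolding holds_def sat_fsubst by (rule sat_cong) (use vars in \<open>auto split: nat.split\<close>)
    have \<chi>p: "(\<Union>n. tpars (case_nat (Par a) Var n :: ('f, 'a) tm)) \<subseteq> {a}"
      by (auto split: nat.splits)
    have "fpars ?\<chi> \<subseteq> B \<inter> B'"
      using fpars_fsubst[of "case_nat (Par a) Var" \<theta>] pars B(1) B'(1) a(1) \<chi>p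
      by blast
    moreover have "wf_fm L ?\<chi>" by (rule wf_fsubst[OF wf]) (simp split: nat.split)
    moreover have "fvars ?\<chi> \<subseteq> {..<1}"
      using vars by (auto simp: fvars_fsubst split: nat.splits)
    ultimately have \<chi>: "?\<chi> \<in> fml L B 1" "?\<chi> \<in> fml L B' 1" "?\<chi> \<in> fml L (universe M) 1"
      using B(2) by (auto simp: fml_def)
    then have "Neg ?\<chi> \<in> fml L B 1" "Neg ?\<chi> \<in> fml L B' 1" by (auto simp: fml_def)
    moreover have "?\<chi> \<in> q \<or> Neg ?\<chi> \<in> q" using \<chi>(3) q by (auto simp: S1_def)
    moreover have "holds M (Neg ?\<chi>) d \<longleftrightarrow> \<not> holds M ?\<chi> d" for d by (simp add: holds_def)
    ultimately have "holds M ?\<chi> c \<longleftrightarrow> holds M ?\<chi> c'"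
      using c c' \<chi>(1,2) unfolding realizes_def by blast
    then show False using s holds_\<chi> by simp
  qed
qed

end

theory Submission
  imports Defs
begin

text \<open>
  Given a productset configuration, compactness yields \<open>c\<close> outside \<open>G\<close> with \<open>\<phi>(b\<^sub>i \<cdot> c)\<close> for all
  \<open>i\<close>, and a type over \<open>Gc\<close> that is finitely satisfied among the \<open>b\<^sub>i\<close> and avoids \<open>G\<close> gives \<open>b\<close>.
  Conversely, a formula in a type that is finitely satisfiable in \<open>G\<close> and not realized in \<open>G\<close> has
  infinitely many solutions in \<open>G\<close>.  Applied to \<open>\<phi>(x \<cdot> c)\<close> this gives the \<open>b\<^sub>i\<close>; applied to the
  finite conjunctions of the \<open>\<phi>(b\<^sub>i \<cdot> y)\<close>, which lie in the type of \<open>c\<close> over the elementary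
  substructure \<open>G\<close>, it gives the \<open>c\<^sub>j\<close>.  The types \<open>p\<close>, \<open>q\<close> of (iii) are global extensions of
  \<open>tp(b/Gc)\<close> and \<open>tp(c/G)\<close>, and \<open>b\<close>, \<open>c\<close> are recovered as realizations of restrictions.
\<close>

subsection \<open>Formulas in one variable\<close>

text \<open>These formulas keep a realization out of a prescribed set; taken over all elements of M
  they express that a global type is nonalgebraic.\<close>

definition distinct_from :: "'a \<Rightarrow> ('f, 'r, 'a) fm" where
  "distinct_from a = Neg (Eq (Var 0) (Par a))"

lemma holds_distinct_from [simp]: "holds M (distinct_from a) x \<longleftrightarrow> x \<noteq> a"
  by (simp add: holds_def distinct_from_def)

lemma holds_Neg [simp]: "holds M (Neg \<phi>) x \<longleftrightarrow> \<not> holds M \<phi> x"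
  by (simp add: holds_def)

lemma distinct_from_fml [simp]: "distinct_from a \<in> fml L A n \<longleftrightarrow> a \<in> A \<and> 0 < n"
  by (auto simp: distinct_from_def fml_def)

lemma Neg_fml [simp]: "Neg \<phi> \<in> fml L A n \<longleftrightarrow> \<phi> \<in> fml L A n"
  by (auto simp: fml_def)

lemma fml_mono: "\<phi> \<in> fml L A n \<Longrightarrow> A \<subseteq> B \<Longrightarrow> \<phi> \<in> fml L B n"
  by (auto simp: fml_def)

lemma finite_conj_fml:
  assumes "finite \<Delta>" "\<Delta> \<subseteq> fml L A 1"
  obtains \<psi> where "\<psi> \<in> fml L A 1" "\<And>a. holds M \<psi> a \<longleftrightarrow> (\<forall>\<delta>\<in>\<Delta>. holds M \<delta> a)"
proof -
  have "\<exists>\<psi>\<in>fml L A 1. \<forall>a. holds M \<psi> a \<longleftrightarrow> (\<forall>\<delta>\<in>\<Delta>. holds M \<delta> a)"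
    using assms
  proof (induction \<Delta>)
    case empty
    \<comment> \<open>The syntax has no truth constant, so \<open>x = x\<close> serves as the empty
      conjunction.\<close>
    have "Eq (Var 0) (Var 0) \<in> fml L A 1" by (simp add: fml_def)
    moreover have "\<forall>a. holds M (Eq (Var 0) (Var 0)) a" by (simp add: holds_def)
    ultimately show ?case by blast
  next
    case (insert \<delta> \<Delta>)
    then obtain \<psi> where \<psi>: "\<psi> \<in> fml L A 1" "\<forall>a. holds M \<psi> a \<longleftrightarrow> (\<forall>\<delta>\<in>\<Delta>. holds M \<delta> a)"
      by auto
    have "And \<delta> \<psi> \<in> fml L A 1" using \<psi>(1) insert.prems by (auto simp: fml_def)
    moreover have "\<forall>a. holds M (And \<delta> \<psi>) a \<longleftrightarrow> (\<forall>\<delta>\<in>insert \<delta> \<Delta>. holds M \<delta> a)"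
      using \<psi>(2) by (auto simp: holds_def)
    ultimately show ?case by blast
  qed
  then show thesis using that by blast
qed

lemma fsubst_fml:
  assumes "\<phi> \<in> fml L A k" "\<And>n. n < k \<Longrightarrow> tvars (\<sigma> n) \<subseteq> {..<l}"
    and "\<And>n. wf_tm L (\<sigma> n)" "\<And>n. tpars (\<sigma> n) \<subseteq> A"
  shows "fsubst \<sigma> \<phi> \<in> fml L A l"
proof -
  have "fpars (fsubst \<sigma> \<phi>) \<subseteq> A"
    using fpars_fsubst[of \<sigma> \<phi>] assms(1,4) by (fastforce simp: fml_def)
  moreover have "fvars (fsubst \<sigma> \<phi>) \<subseteq> {..<l}"
    using assms(1,2) by (fastforce simp: fml_def fvars_fsubst)
  ultimately show ?thesis using assms(1,3) by (simp add: fml_def wf_fsubst)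
qed

lemma sat_fml_1: "\<phi> \<in> fml L A 1 \<Longrightarrow> sat M e \<phi> \<longleftrightarrow> holds M \<phi> (e 0)"
  unfolding holds_def by (rule sat_cong) (auto simp: fml_def)

lemma holds_fsubst: "\<phi> \<in> fml L A 1 \<Longrightarrow> holds M (fsubst \<sigma> \<phi>) a \<longleftrightarrow> holds M \<phi> (tval M (\<lambda>_. a) (\<sigma> 0))"
  unfolding holds_def[of M "fsubst \<sigma> \<phi>"] sat_fsubst by (rule sat_fml_1)

subsection \<open>Finite satisfiability and complete types\<close>

text \<open>The set \<open>X\<close> of admissible witnesses is a parameter: the universe of M gives
  consistency, the universe of G gives coheirs. Unlike \<open>finsat_in\<close>, the condition
  concerns finite subsets, so it makes sense for sets not closed under conjunction.\<close>

definition fin_sat :: "('f, 'r, 'a) fo_struct \<Rightarrow> 'a set \<Rightarrow> ('f, 'r, 'a) fm set \<Rightarrow> bool" where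
  "fin_sat M X \<Sigma> \<longleftrightarrow> (\<forall>\<Delta>. finite \<Delta> \<and> \<Delta> \<subseteq> \<Sigma> \<longrightarrow> (\<exists>a\<in>X. \<forall>\<phi>\<in>\<Delta>. holds M \<phi> a))"

lemma fin_satD: "fin_sat M X \<Sigma> \<Longrightarrow> finite \<Delta> \<Longrightarrow> \<Delta> \<subseteq> \<Sigma> \<Longrightarrow> \<exists>a\<in>X. \<forall>\<phi>\<in>\<Delta>. holds M \<phi> a"
  by (simp add: fin_sat_def)

lemma not_fin_satE:
  assumes "\<not> fin_sat M X \<Sigma>"
  obtains \<Delta> where "finite \<Delta>" "\<Delta> \<subseteq> \<Sigma>" "\<forall>a\<in>X. \<exists>\<delta>\<in>\<Delta>. \<not> holds M \<delta> a"
  using assms by (auto simp: fin_sat_def)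

lemma finsat_inD: "finsat_in M p A \<Longrightarrow> \<phi> \<in> p \<Longrightarrow> \<exists>a\<in>A. holds M \<phi> a"
  by (simp add: finsat_in_def)

lemma S1_iff:
  "p \<in> S1 L M A \<longleftrightarrow>
     p \<subseteq> fml L A 1 \<and> fin_sat M (universe M) p \<and> (\<forall>\<phi>\<in>fml L A 1. \<phi> \<in> p \<or> Neg \<phi> \<in> p)"
  by (simp add: S1_def fin_sat_def)

text \<open>By Zorn there is a maximal extension whose finite parts have witnesses in
  \<open>X\<close>, and maximality forces completeness. Since witnesses never leave
  \<open>X\<close>, the complete type is still finitely satisfiable there.\<close>

lemma fin_sat_extend:
  assumes "\<Sigma> \<subseteq> fml L A 1" "fin_sat M X \<Sigma>" "X \<subseteq> universe M"
  obtains p where "p \<in> S1 L M A" "\<Sigma> \<subseteq> p" "finsat_in M p X"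
proof -
  let ?P = "{p. \<Sigma> \<subseteq> p \<and> p \<subseteq> fml L A 1 \<and> fin_sat M X p}"
  have "\<exists>p\<in>?P. \<forall>q\<in>?P. p \<subseteq> q \<longrightarrow> q = p"
  proof (rule subset_Zorn_nonempty)
    show "?P \<noteq> {}" using assms by blast
    fix C assume C: "C \<noteq> {}" "subset.chain ?P C"
    then have sub: "C \<subseteq> ?P" by (simp add: subset_chain_def)
    have "fin_sat M X (\<Union>C)"
      unfolding fin_sat_def
    proof (intro allI impI)
      fix \<Delta> assume "finite \<Delta> \<and> \<Delta> \<subseteq> \<Union>C"
      then obtain p where "p \<in> C" "\<Delta> \<subseteq> p" "finite \<Delta>"
        using finite_subset_Union_chain[OF _ _ C] by metis
      then show "\<exists>a\<in>X. \<forall>\<phi>\<in>\<Delta>. holds M \<phi> a" using sub fin_satD[of M X p \<Delta>] by blast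
    qed
    then show "\<Union>C \<in> ?P" using sub C(1) by blast
  qed
  then obtain p where pP: "p \<in> ?P" and max: "\<forall>q\<in>?P. p \<subseteq> q \<longrightarrow> q = p" by (rule bexE)
  then have p: "\<Sigma> \<subseteq> p" "p \<subseteq> fml L A 1" "fin_sat M X p" by auto
  \<comment> \<open>A formula that cannot be added to the maximal \<open>p\<close> is refuted on
    \<open>X\<close> by finitely many members of \<open>p\<close>.\<close>
  have refuted: "\<exists>\<Delta>. finite \<Delta> \<and> \<Delta> \<subseteq> p \<and> (\<forall>a\<in>X. (\<forall>\<delta>\<in>\<Delta>. holds M \<delta> a) \<longrightarrow> \<not> holds M \<psi> a)"
    if "\<psi> \<in> fml L A 1" "\<psi> \<notin> p" for \<psi>
  proof -
    have "insert \<psi> p \<notin> ?P" using max that(2) by blast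
    then have "\<not> fin_sat M X (insert \<psi> p)" using p that(1) by blast
    then obtain \<Delta> where \<Delta>: "finite \<Delta>" "\<Delta> \<subseteq> insert \<psi> p" "\<forall>a\<in>X. \<exists>\<delta>\<in>\<Delta>. \<not> holds M \<delta> a"
      by (rule not_fin_satE)
    then have "finite (\<Delta> - {\<psi>}) \<and> \<Delta> - {\<psi>} \<subseteq> p \<and>
        (\<forall>a\<in>X. (\<forall>\<delta>\<in>\<Delta> - {\<psi>}. holds M \<delta> a) \<longrightarrow> \<not> holds M \<psi> a)" by blast
    then show ?thesis by blast
  qed
  have "\<psi> \<in> p \<or> Neg \<psi> \<in> p" if \<psi>: "\<psi> \<in> fml L A 1" for \<psi>
  proof (rule ccontr)
    assume "\<not> ?thesis"
    \<comment> \<open>If both the formula and its negation are refuted, the union of the two finite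
      parts has no solution in \<open>X\<close>.\<close>
    then obtain \<Delta> \<Delta>' where \<Delta>: "finite (\<Delta> \<union> \<Delta>')" "\<Delta> \<union> \<Delta>' \<subseteq> p"
      and "\<forall>a\<in>X. (\<forall>\<delta>\<in>\<Delta>. holds M \<delta> a) \<longrightarrow> \<not> holds M \<psi> a"
      and "\<forall>a\<in>X. (\<forall>\<delta>\<in>\<Delta>'. holds M \<delta> a) \<longrightarrow> \<not> holds M (Neg \<psi>) a"
      using refuted[of \<psi>] refuted[of "Neg \<psi>"] \<psi> by auto
    then show False using fin_satD[OF p(3) \<Delta>] by auto
  qed
  moreover have "fin_sat M (universe M) p" using p(3) assms(3) unfolding fin_sat_def by blast
  ultimately have "p \<in> S1 L M A" using p(2) by (simp add: S1_iff)
  moreover have "finsat_in M p X"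
    unfolding finsat_in_def using fin_satD[OF p(3)] by (metis empty_subsetI finite.emptyI
        finite.insertI insertI1 insert_subset)
  ultimately show thesis using that p(1) by blast
qed

text \<open>A finite part excludes only finitely many points, which cannot exhaust an infinite
  solution set. Hence \<open>D\<close> may be arbitrarily large, even all of M while
  \<open>X\<close> is G.\<close>

lemma fin_sat_avoid:
  assumes inf: "\<And>\<Delta>. finite \<Delta> \<Longrightarrow> \<Delta> \<subseteq> \<Sigma> \<Longrightarrow> infinite {a \<in> X. \<forall>\<phi>\<in>\<Delta>. holds M \<phi> a}"
  shows "fin_sat M X (\<Sigma> \<union> distinct_from ` D)"
  unfolding fin_sat_def
proof (intro allI impI)
  fix \<Delta> assume \<Delta>: "finite \<Delta> \<and> \<Delta> \<subseteq> \<Sigma> \<union> distinct_from ` D"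
  then have "finite (\<Delta> - \<Sigma>)" "\<Delta> - \<Sigma> \<subseteq> distinct_from ` D" by auto
  then obtain S where S: "finite S" "\<Delta> - \<Sigma> = distinct_from ` S"
    using finite_subset_image by metis
  have "infinite ({a \<in> X. \<forall>\<phi>\<in>\<Delta> \<inter> \<Sigma>. holds M \<phi> a} - S)"
    using inf[of "\<Delta> \<inter> \<Sigma>"] \<Delta> S(1) by (simp add: Diff_infinite_finite)
  then obtain a where a: "a \<in> X" "\<forall>\<phi>\<in>\<Delta> \<inter> \<Sigma>. holds M \<phi> a" "a \<notin> S"
    using infinite_imp_nonempty by blast
  have "holds M \<phi> a" if "\<phi> \<in> \<Delta>" for \<phi>
  proof (cases "\<phi> \<in> \<Sigma>")
    case False
    then have "\<phi> \<in> distinct_from ` S" using that S(2) by blast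
    then show ?thesis using a(3) by auto
  qed (use a that in blast)
  then show "\<exists>a\<in>X. \<forall>\<phi>\<in>\<Delta>. holds M \<phi> a" using a(1) by blast
qed

text \<open>Otherwise completeness puts the negation into \<open>p\<close>, and a common solution of
  it and \<open>\<Delta>\<close> contradicts the implication.\<close>

lemma S1_consequence:
  assumes "p \<in> S1 L M A" "finite \<Delta>" "\<Delta> \<subseteq> p" "\<psi> \<in> fml L A 1"
    and "\<And>a. \<forall>\<delta>\<in>\<Delta>. holds M \<delta> a \<Longrightarrow> holds M \<psi> a"
  shows "\<psi> \<in> p"
proof (rule ccontr)
  assume "\<psi> \<notin> p"
  then have "insert (Neg \<psi>) \<Delta> \<subseteq> p" using assms by (auto simp: S1_iff)
  moreover have "fin_sat M (universe M) p" using assms(1) by (simp add: S1_iff)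
  ultimately obtain a where "\<forall>\<delta>\<in>insert (Neg \<psi>) \<Delta>. holds M \<delta> a"
    using fin_satD[of M "universe M" p "insert (Neg \<psi>) \<Delta>"] assms(2) by auto
  then show False using assms(5)[of a] by auto
qed

lemma S1_restrict: "p \<in> S1 L M A \<Longrightarrow> B \<subseteq> A \<Longrightarrow> p \<inter> fml L B 1 \<in> S1 L M B"
  unfolding S1_iff fin_sat_def using fml_mono[of _ L B 1 A] by (auto simp: fml_mono)

text \<open>By completeness, a formula true at \<open>b\<close> but missing from \<open>p\<close>
  has its negation in \<open>p\<close>, which \<open>b\<close> would satisfy. This lets finite
  satisfiability pass from \<open>p\<close> to the type of a realization.\<close>

lemma S1_restrict_eq_tp:
  assumes "p \<in> S1 L M A" "B \<subseteq> A" "realizes M b (p \<inter> fml L B 1)"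
  shows "p \<inter> fml L B 1 = tp L M b B"
proof -
  have "\<psi> \<in> p" if "\<psi> \<in> fml L B 1" "holds M \<psi> b" for \<psi>
  proof (rule ccontr)
    assume "\<psi> \<notin> p"
    then have "Neg \<psi> \<in> p \<inter> fml L B 1"
      using that(1) assms(1) fml_mono[OF that(1) assms(2)] by (auto simp: S1_iff)
    then have "holds M (Neg \<psi>) b" using assms(3) unfolding realizes_def by blast
    then show False using that(2) by simp
  qed
  then show ?thesis using assms(3) by (auto simp: tp_def realizes_def)
qed

lemma S1_extending_tp:
  assumes "p \<in> S1 L M A" "tp L M b B \<subseteq> p" "b \<in> universe M"
  shows "realizes M b (p \<inter> fml L B 1)"
  unfolding realizes_def
proof (intro conjI ballI)
  fix \<psi> assume \<psi>: "\<psi> \<in> p \<inter> fml L B 1"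
  show "holds M \<psi> b"
  proof (rule ccontr)
    assume "\<not> holds M \<psi> b"
    then have "{\<psi>, Neg \<psi>} \<subseteq> p" using assms(2) \<psi> by (auto simp: tp_def)
    moreover have "fin_sat M (universe M) p" using assms(1) by (simp add: S1_iff)
    ultimately show False using fin_satD[of M "universe M" p "{\<psi>, Neg \<psi>}"] by auto
  qed
qed (fact assms(3))

lemma nonalgebraic_iff:
  assumes "p \<in> S1 L M (universe M)"
  shows "nonalgebraic M p \<longleftrightarrow> distinct_from ` universe M \<subseteq> p"
proof
  assume na: "nonalgebraic M p"
  show "distinct_from ` universe M \<subseteq> p"
  proof (rule image_subsetI, rule ccontr)
    fix d assume d: "d \<in> universe M" "distinct_from d \<notin> p"
    then have neg: "Neg (distinct_from d) \<in> p" using assms by (auto simp: S1_iff)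
    have "holds M \<psi> d" if "\<psi> \<in> p" for \<psi>
    proof (rule ccontr)
      assume "\<not> holds M \<psi> d"
      \<comment> \<open>If \<open>\<psi>\<close> fails at \<open>d\<close>, every solution of
        \<open>\<psi>\<close> differs from \<open>d\<close>, so \<open>p\<close> contains
        \<open>distinct_from d\<close> by closure under consequence. Thus \<open>d\<close> satisfies
        all of \<open>p\<close>.\<close>
      then have "distinct_from d \<in> p"
        using d(1) that by (intro S1_consequence[OF assms, of "{\<psi>}"]) auto
      then show False using d(2) by blast
    qed
    then show False using na d(1) by (auto simp: nonalgebraic_def realizes_def)
  qed
next
  assume "distinct_from ` universe M \<subseteq> p"
  then show "nonalgebraic M p" by (force simp: nonalgebraic_def realizes_def)
qed

lemma nonalgebraic_realization_notin:
  fixes M :: "('f, 'r, 'a) fo_struct"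
  assumes "p \<in> S1 L M (universe M)" "nonalgebraic M p" "B \<subseteq> universe M"
    and "realizes M b (p \<inter> fml L B 1)"
  shows "b \<notin> B"
proof
  assume "b \<in> B"
  then have "distinct_from b \<in> p \<inter> fml L B 1" using assms by (auto simp: nonalgebraic_iff)
  then have "holds M (distinct_from b :: ('f, 'r, 'a) fm) b"
    using assms(4) unfolding realizes_def by blast
  then show False by simp
qed

lemma finsat_in_mono: "finsat_in M p A \<Longrightarrow> q \<subseteq> p \<Longrightarrow> finsat_in M q A"
  by (auto simp: finsat_in_def)

text \<open>If there were only finitely many solutions in \<open>A\<close>, excluding them would
  give a formula over \<open>B\<close> that is still true at \<open>b\<close>, because
  \<open>b\<close> is outside \<open>A\<close>. Finite satisfiability would then produce one more
  solution in \<open>A\<close>.\<close>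

lemma infinite_coheir_solutions:
  assumes "finsat_in M (tp L M b B) A" "A \<subseteq> B" "b \<notin> A" "finite \<Delta>" "\<Delta> \<subseteq> tp L M b B"
  shows "infinite {a \<in> A. \<forall>\<delta>\<in>\<Delta>. holds M \<delta> a}"
proof
  let ?S = "{a \<in> A. \<forall>\<delta>\<in>\<Delta>. holds M \<delta> a}"
  assume "finite ?S"
  then have "finite (\<Delta> \<union> distinct_from ` ?S)" "\<Delta> \<union> distinct_from ` ?S \<subseteq> fml L B 1"
    using assms(2,4,5) by (auto simp: tp_def)
  from finite_conj_fml[OF this, of M] obtain \<psi> where \<psi>: "\<psi> \<in> fml L B 1"
    "\<And>a. holds M \<psi> a \<longleftrightarrow> (\<forall>\<delta>\<in>\<Delta> \<union> distinct_from ` ?S. holds M \<delta> a)"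
    by blast
  have "holds M \<delta> b" if "\<delta> \<in> \<Delta> \<union> distinct_from ` ?S" for \<delta>
    using that assms(3,5) by (auto simp: tp_def)
  then have "holds M \<psi> b" using \<psi>(2) by blast
  then have "\<psi> \<in> tp L M b B" using \<psi>(1) by (simp add: tp_def)
  then obtain a where a: "a \<in> A" "holds M \<psi> a" using finsat_inD[OF assms(1)] by blast
  have sol: "holds M \<delta> a" if "\<delta> \<in> \<Delta> \<union> distinct_from ` ?S" for \<delta> using a(2) \<psi>(2) that by blast
  then have "a \<in> ?S" using a(1) by blast
  then show False using sol[of "distinct_from a"] by simp
qed

section \<open>Transfer along the elementary extension\<close>

lemma elem_ext_holds:
  assumes "elem_ext L G M" "\<phi> \<in> fml L (universe G) 1" "a \<in> universe G"
  shows "holds G \<phi> a \<longleftrightarrow> holds M \<phi> a"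
proof -
  have "range (\<lambda>_::nat. a) \<subseteq> universe G" using assms(3) by auto
  then show ?thesis using assms(1,2) unfolding elem_ext_def holds_def by blast
qed

text \<open>A formula over G true at \<open>c\<close> makes its existential closure true in M, hence
  in G by elementarity.\<close>

lemma elem_ext_finsat_tp:
  assumes "elem_ext L G M" "c \<in> universe M"
  shows "finsat_in M (tp L M c (universe G)) (universe G)"
  unfolding finsat_in_def
proof
  fix \<psi> assume "\<psi> \<in> tp L M c (universe G)"
  then have \<psi>: "\<psi> \<in> fml L (universe G) 1" "holds M \<psi> c" by (auto simp: tp_def)
  \<comment> \<open>Even a closed formula is evaluated in an environment, and
    \<open>elem_ext\<close> asks for one with values in G; \<open>g\<close> is an arbitrary
    default.\<close>
  obtain g where g: "g \<in> universe G" using assms(1) by (auto simp: elem_ext_def is_struct_def)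
  have s: "sat N (case_nat a (\<lambda>_. g)) \<psi> \<longleftrightarrow> holds N \<psi> a" for N a
    using sat_fml_1[OF \<psi>(1), of N "case_nat a (\<lambda>_. g)"] by simp
  have "Exists \<psi> \<in> fml L (universe G) 0" using \<psi>(1) by (auto simp: fml_def)
  moreover have "range (\<lambda>_::nat. g) \<subseteq> universe G" using g by auto
  ultimately have "sat G (\<lambda>_. g) (Exists \<psi>) \<longleftrightarrow> sat M (\<lambda>_. g) (Exists \<psi>)"
    using assms(1) unfolding elem_ext_def by blast
  then obtain a where "a \<in> universe G" "holds G \<psi> a" using s \<psi>(2) assms(2) by auto
  then show "\<exists>a\<in>universe G. holds M \<psi> a" using elem_ext_holds[OF assms(1) \<psi>(1)] by blast
qed

section \<open>Distinct choices and small sets\<close>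

lemma inj_choice:
  fixes C :: "nat \<Rightarrow> 'a set"
  assumes "\<And>n. infinite (C n)"
  obtains c where "inj c" "\<And>n. c n \<in> C n"
proof -
  have ex: "\<exists>x. x \<in> C n \<and> x \<notin> S" if "finite S" for n S
    using assms[of n] that by (meson finite_subset subsetI)
  \<comment> \<open>The recursion state pairs the finite set of values used so far with the current
    value; each new value avoids the previous set.\<close>
  have "\<exists>f. \<forall>n. (finite (fst (f n)) \<and> snd (f n) \<in> C n \<and> snd (f n) \<in> fst (f n)) \<and>
      fst (f n) \<subseteq> fst (f (Suc n)) \<and> snd (f (Suc n)) \<notin> fst (f n)"
  proof (rule dependent_nat_choice)
    obtain x where "x \<in> C 0" using ex[of "{}"] by auto
    then show "\<exists>s. finite (fst s) \<and> snd s \<in> C 0 \<and> snd s \<in> fst s" by (intro exI[of _ "({x}, x)"]) simp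
  next
    fix s :: "'a set \<times> 'a" and n
    assume "finite (fst s) \<and> snd s \<in> C n \<and> snd s \<in> fst s"
    moreover from this obtain x where "x \<in> C (Suc n)" "x \<notin> fst s" using ex by blast
    ultimately show "\<exists>t. (finite (fst t) \<and> snd t \<in> C (Suc n) \<and> snd t \<in> fst t) \<and>
        fst s \<subseteq> fst t \<and> snd t \<notin> fst s"
      by (intro exI[of _ "(insert x (fst s), x)"]) auto
  qed
  then obtain f where f: "\<And>n. snd (f n) \<in> C n" "\<And>n. snd (f n) \<in> fst (f n)"
    "\<And>n. fst (f n) \<subseteq> fst (f (Suc n))" "\<And>n. snd (f (Suc n)) \<notin> fst (f n)" by blast
  have "snd (f i) \<noteq> snd (f j)" if "i < j" for i j
  proof -
    obtain k where k: "j = Suc k" "i \<le> k" using \<open>i < j\<close> by (cases j) auto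
    then have "fst (f i) \<subseteq> fst (f k)" using f(3) lift_Suc_mono_le[of "\<lambda>n. fst (f n)"] by blast
    then show ?thesis using f(2)[of i] f(4)[of k] k(1) by auto
  qed
  then have "inj (\<lambda>n. snd (f n))" by (metis injI linorder_neqE_nat)
  then show thesis using that f(1) by blast
qed

lemma card_insert_less:
  assumes "Card_order \<kappa>" "infinite (Field \<kappa>)" "|A| <o \<kappa>"
  shows "|insert x A| <o \<kappa>"
proof -
  have "|{x} \<union> A| <o \<kappa>"
  proof (rule card_of_Un_ordLess_infinite_Field)
    show "|{x}| <o \<kappa>"
      using assms card_order_on_well_order_on
      by (intro finite_ordLess_infinite card_of_Well_order) (auto simp: Field_card_of)
  qed (use assms in auto)
  then show ?thesis by simp
qed

subsection \<open>Productsets and coheirs\<close>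

text \<open>The substitution may send every index to the same term because \<open>\<phi>\<close>
  will have no free variable besides index 0.\<close>

definition left_mult :: "'f \<Rightarrow> 'a \<Rightarrow> ('f, 'r, 'a) fm \<Rightarrow> ('f, 'r, 'a) fm" where
  "left_mult m d = fsubst (\<lambda>_. App m [Par d, Var 0])"

definition right_mult :: "'f \<Rightarrow> 'a \<Rightarrow> ('f, 'r, 'a) fm \<Rightarrow> ('f, 'r, 'a) fm" where
  "right_mult m d = fsubst (\<lambda>_. App m [Var 0, Par d])"

locale group_monster =
  fixes L :: "('f, 'r) lang" and G M :: "('f, 'r, 'a) fo_struct"
    and H :: "('a, 'b) monoid_scheme" and m :: 'f and \<kappa> :: "'k rel" and \<phi> :: "('f, 'r, 'a) fm"
  assumes expands: "expands_group L G m H"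
    and mon: "monster L \<kappa> G M"
    and \<phi>: "\<phi> \<in> fml L (universe G) 1"
begin

lemma ext: "elem_ext L G M" using mon by (simp add: monster_def)

lemma G_sub: "universe G \<subseteq> universe M" using ext by (simp add: elem_ext_def)

lemma m_arity: "fun_arity L m = Some 2" using expands by (simp add: expands_group_def)

lemma carrier_H: "carrier H = universe G" using expands by (simp add: expands_group_def)

lemma realize:
  assumes "p \<in> S1 L M A" "A \<subseteq> universe M" "|A| <o \<kappa>"
  obtains b where "realizes M b p"
  using assms mon unfolding monster_def saturated_def by blast

lemma small_G: "|universe G| <o \<kappa>" using mon by (simp add: monster_def)

lemma small_insert_G: "|insert c (universe G)| <o \<kappa>"
  using mon by (auto simp: monster_def intro: card_insert_less)

lemma holds_mult [simp]:
  "holds M (left_mult m d \<phi>) a \<longleftrightarrow> holds M \<phi> (fun_int M m [d, a])"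
  "holds M (right_mult m d \<phi>) a \<longleftrightarrow> holds M \<phi> (fun_int M m [a, d])"
  unfolding left_mult_def right_mult_def using \<phi> by (simp_all add: holds_fsubst)

lemma mult_fml:
  "left_mult m d \<phi> \<in> fml L (insert d (universe G)) 1"
  "right_mult m d \<phi> \<in> fml L (insert d (universe G)) 1"
  unfolding left_mult_def right_mult_def
  using fml_mono[OF \<phi>, of "insert d (universe G)"] m_arity by (auto intro!: fsubst_fml)

lemma left_mult_fml: "d \<in> universe G \<Longrightarrow> left_mult m d \<phi> \<in> fml L (universe G) 1"
  using mult_fml(1)[of d] by (simp add: insert_absorb)

text \<open>The products in H, G and M agree on G, and elementarity transfers \<open>\<phi>\<close>;
  so membership can be decided in M, where the elements outside G live.\<close>

lemma mult_in_defset: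
  assumes "g \<in> universe G" "h \<in> universe G"
  shows "g \<otimes>\<^bsub>H\<^esub> h \<in> defset G \<phi> \<longleftrightarrow> holds M \<phi> (fun_int M m [g, h])"
proof -
  have "fun_int G m [g, h] = g \<otimes>\<^bsub>H\<^esub> h" using expands assms by (simp add: expands_group_def)
  moreover have "fun_int G m [g, h] = fun_int M m [g, h]"
    using ext assms m_arity unfolding elem_ext_def by (simp add: numeral_2_eq_2)
  moreover have "g \<otimes>\<^bsub>H\<^esub> h \<in> universe G"
    using expands assms by (metis carrier_H expands_group_def group.is_monoid monoid.m_closed)
  ultimately show ?thesis using elem_ext_holds[OF ext \<phi>] by (auto simp: defset_def)
qed

section \<open>Productsets and coheir substantiality\<close>

lemma coheir_substantial_if_productset:
  assumes "one_sided_productset H (defset G \<phi>)"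
  shows "coheir_substantial L G M m \<phi>"
proof -
  obtain b c :: "nat \<Rightarrow> 'a" where inj: "inj b" "inj c"
    and ran: "range b \<subseteq> universe G" "range c \<subseteq> universe G"
    and prod: "\<forall>i j. i \<le> j \<longrightarrow> b i \<otimes>\<^bsub>H\<^esub> c j \<in> defset G \<phi>"
    using assms unfolding one_sided_productset_def carrier_H by (elim exE conjE)
  have bc: "b i \<in> universe G" "c i \<in> universe G" for i using ran by auto
  let ?\<Sigma> = "range (\<lambda>i. left_mult m (b i) \<phi>)"
  have "infinite {a \<in> universe G. \<forall>\<delta>\<in>\<Delta>. holds M \<delta> a}" if \<Delta>: "finite \<Delta>" "\<Delta> \<subseteq> ?\<Sigma>" for \<Delta>
  proof -
    obtain I where I: "finite I" "\<Delta> = (\<lambda>i. left_mult m (b i) \<phi>) ` I"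
      using finite_subset_image[OF \<Delta>] by blast
    \<comment> \<open>\<open>N\<close> bounds the indices of the finitely many \<open>b i\<close>
      involved, so every \<open>c j\<close> with \<open>N \<le> j\<close> is a solution;
      \<open>insert 0\<close> covers empty \<open>I\<close>.\<close>
    define N where "N = Max (insert 0 I)"
    have "c ` {N..} \<subseteq> {a \<in> universe G. \<forall>\<delta>\<in>\<Delta>. holds M \<delta> a}"
    proof (clarsimp simp: I(2) bc)
      fix j i assume "N \<le> j" "i \<in> I"
      then have "i \<le> j" using I(1) unfolding N_def by auto
      then show "holds M \<phi> (fun_int M m [b i, c j])" using prod mult_in_defset bc by blast
    qed
    moreover have "infinite (c ` {N..})"
      using inj(2) by (simp add: finite_image_iff inj_on_subset infinite_Ici)
    ultimately show ?thesis using finite_subset by blast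
  qed
  then have fs: "fin_sat M (universe G) (?\<Sigma> \<union> distinct_from ` universe G)" by (rule fin_sat_avoid)
  have "?\<Sigma> \<union> distinct_from ` universe G \<subseteq> fml L (universe G) 1"
    using left_mult_fml bc by auto
  from fin_sat_extend[OF this fs G_sub]
  obtain q where q: "q \<in> S1 L M (universe G)" "?\<Sigma> \<union> distinct_from ` universe G \<subseteq> q" .
  then obtain c' where c': "realizes M c' q" using realize[OF _ G_sub small_G] by blast
  have "holds M (left_mult m (b i) \<phi>) c'" for i using c' q(2) unfolding realizes_def by blast
  then have bc': "holds M \<phi> (fun_int M m [b i, c'])" for i by simp
  have "c' \<notin> universe G"
  proof
    assume "c' \<in> universe G"
    then have "holds M (distinct_from c' :: ('f, 'r, 'a) fm) c'"
      using c' q(2) unfolding realizes_def by blast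
    then show False by simp
  qed
  then have c'M: "c' \<in> universe M - universe G" using c' by (simp add: realizes_def)
  let ?B = "insert c' (universe G)"
  have B: "?B \<subseteq> universe M" using c'M G_sub by auto
  \<comment> \<open>Every \<open>b i\<close> solves \<open>\<phi>(x \<cdot> c')\<close>, since
    \<open>c'\<close> realizes all the formulas \<open>\<phi>(b i \<cdot> y)\<close>.\<close>
  have "infinite {a \<in> universe G. \<forall>\<delta>\<in>\<Delta>. holds M \<delta> a}" if "\<Delta> \<subseteq> {right_mult m c' \<phi>}" for \<Delta>
  proof -
    have "range b \<subseteq> {a \<in> universe G. \<forall>\<delta>\<in>\<Delta>. holds M \<delta> a}" using bc(1) bc' that by auto
    moreover have "infinite (range b)" using inj(1) by (simp add: finite_image_iff)
    ultimately show ?thesis using finite_subset by blast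
  qed
  then have fs': "fin_sat M (universe G) ({right_mult m c' \<phi>} \<union> distinct_from ` universe G)"
    by (rule fin_sat_avoid)
  have "{right_mult m c' \<phi>} \<union> distinct_from ` universe G \<subseteq> fml L ?B 1"
    using mult_fml by auto
  from fin_sat_extend[OF this fs' G_sub]
  obtain p where p: "p \<in> S1 L M ?B" "{right_mult m c' \<phi>} \<union> distinct_from ` universe G \<subseteq> p"
    "finsat_in M p (universe G)" .
  then obtain b' where b': "realizes M b' p" using realize[OF _ B small_insert_G] by blast
  have "b' \<notin> universe G"
  proof
    assume "b' \<in> universe G"
    then have "holds M (distinct_from b' :: ('f, 'r, 'a) fm) b'"
      using b' p(2) unfolding realizes_def by blast
    then show False by simp
  qed
  moreover have "b' \<in> universe M" using b' by (simp add: realizes_def)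
  moreover have "holds M (right_mult m c' \<phi>) b'" using b' p(2) unfolding realizes_def by blast
  \<comment> \<open>As \<open>p\<close> is complete over \<open>?B\<close>, its finite
    satisfiability in G is that of the type of \<open>b'\<close>.\<close>
  moreover have "p = tp L M b' ?B"
    using S1_restrict_eq_tp[OF p(1) order_refl, of b'] b' p(1) by (simp add: S1_iff Int_absorb2)
  ultimately show ?thesis
    unfolding coheir_substantial_def using c'M p(3) by auto
qed

lemma productset_if_coheir_substantial:
  assumes "coheir_substantial L G M m \<phi>"
  shows "one_sided_productset H (defset G \<phi>)"
proof -
  obtain b c where b: "b \<in> universe M - universe G" and c: "c \<in> universe M - universe G"
    and bc: "holds M \<phi> (fun_int M m [b, c])"
    and fs: "finsat_in M (tp L M b (insert c (universe G))) (universe G)"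
    using assms unfolding coheir_substantial_def by blast
  have "{right_mult m c \<phi>} \<subseteq> tp L M b (insert c (universe G))"
    using mult_fml bc by (simp add: tp_def)
  then have "infinite {a \<in> universe G. \<forall>\<delta>\<in>{right_mult m c \<phi>}. holds M \<delta> a}"
    using infinite_coheir_solutions[OF fs] b by blast
  then obtain \<beta> :: "nat \<Rightarrow> 'a" where "inj \<beta>"
    and "\<And>i. \<beta> i \<in> {a \<in> universe G. \<forall>\<delta>\<in>{right_mult m c \<phi>}. holds M \<delta> a}"
    using inj_choice[of "\<lambda>_. {a \<in> universe G. \<forall>\<delta>\<in>{right_mult m c \<phi>}. holds M \<delta> a}"] by blast
  then have \<beta>: "inj \<beta>" "\<And>i. \<beta> i \<in> universe G" "\<And>i. holds M \<phi> (fun_int M m [\<beta> i, c])"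
    by auto
  \<comment> \<open>Stage \<open>n\<close> collects the conditions from \<open>\<beta> 0\<close> up
    to and including \<open>\<beta> n\<close>, so that \<open>\<gamma> j\<close> serves all
    \<open>i \<le> j\<close>. All of them hold at \<open>c\<close>.\<close>
  let ?\<Delta> = "\<lambda>n. (\<lambda>i. left_mult m (\<beta> i) \<phi>) ` {..n}"
  have "infinite {a \<in> universe G. \<forall>\<delta>\<in>?\<Delta> n. holds M \<delta> a}" for n
  proof (rule infinite_coheir_solutions[OF elem_ext_finsat_tp[OF ext]])
    show "?\<Delta> n \<subseteq> tp L M c (universe G)" using \<beta>(2,3) left_mult_fml by (auto simp: tp_def)
  qed (use c in auto)
  then obtain \<gamma> :: "nat \<Rightarrow> 'a" where "inj \<gamma>"
    and "\<And>n. \<gamma> n \<in> {a \<in> universe G. \<forall>\<delta>\<in>?\<Delta> n. holds M \<delta> a}"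
    using inj_choice[of "\<lambda>n. {a \<in> universe G. \<forall>\<delta>\<in>?\<Delta> n. holds M \<delta> a}"] by blast
  then have \<gamma>: "inj \<gamma>" "\<And>j. \<gamma> j \<in> universe G"
    "\<And>i j. i \<le> j \<Longrightarrow> holds M \<phi> (fun_int M m [\<beta> i, \<gamma> j])"
    by auto
  have "\<beta> i \<otimes>\<^bsub>H\<^esub> \<gamma> j \<in> defset G \<phi>" if "i \<le> j" for i j
    using that \<beta>(2) \<gamma>(2,3) mult_in_defset by blast
  then show ?thesis
    unfolding one_sided_productset_def carrier_H using \<beta>(1,2) \<gamma>(1,2) by blast
qed

section \<open>Global types and their product\<close>

abbreviation product_fm :: "('f, 'r, 'a) fm" where
  "product_fm \<equiv> fsubst (Var(0 := App m [Var 0, Var 1])) \<phi>"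

text \<open>\<open>product_fm\<close> has \<open>x\<close> at index 0 and \<open>y\<close> at index
  1, as \<open>tensor\<close> expects; plugging in \<open>c\<close> for \<open>y\<close> leaves a
  formula in index 0 alone.\<close>

lemma holds_product_inst:
  "holds M (fsubst (Var(1 := Par c)) product_fm) a \<longleftrightarrow> holds M \<phi> (fun_int M m [a, c])"
  unfolding holds_def[of M "fsubst _ product_fm"] sat_fsubst using sat_fml_1[OF \<phi>] by simp

lemma product_fml: "product_fm \<in> fml L (universe G) 2"
  using m_arity by (intro fsubst_fml[OF \<phi>]) (auto split: if_splits)

lemma product_inst_fml:
  "fsubst (Var(1 := Par c)) product_fm \<in> fml L (insert c (universe G)) 1"
  using fml_mono[OF product_fml, of "insert c (universe G)"]
  by (rule fsubst_fml) (auto split: if_splits)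

lemma global_types_if_coheir_substantial:
  assumes "coheir_substantial L G M m \<phi>"
  shows "\<exists>p \<in> S1 L M (universe M). \<exists>q \<in> S1 L M (universe M).
    nonalgebraic M p \<and> nonalgebraic M q \<and> finsat_in M p (universe G) \<and>
    product_fm \<in> tensor L \<kappa> M (universe G) p q"
proof -
  obtain b c where b: "b \<in> universe M - universe G" and c: "c \<in> universe M - universe G"
    and bc: "holds M \<phi> (fun_int M m [b, c])"
    and fs: "finsat_in M (tp L M b (insert c (universe G))) (universe G)"
    using assms unfolding coheir_substantial_def by blast
  \<comment> \<open>One construction yields both \<open>p\<close> and \<open>q\<close>: formulas
    true at a point outside G whose type is finitely satisfiable in G have infinitely many solutions
    in G, so all points of M can be excluded at once.\<close>
  have extend: "\<exists>p\<in>S1 L M (universe M).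
      tp L M d B \<subseteq> p \<and> nonalgebraic M p \<and> finsat_in M p (universe G)"
    if "finsat_in M (tp L M d B) (universe G)" "universe G \<subseteq> B" "B \<subseteq> universe M" "d \<notin> universe G"
    for d B
  proof -
    have fs: "fin_sat M (universe G) (tp L M d B \<union> distinct_from ` universe M)"
      using infinite_coheir_solutions[OF that(1,2,4)] by (rule fin_sat_avoid)
    have "tp L M d B \<union> distinct_from ` universe M \<subseteq> fml L (universe M) 1"
      using fml_mono[OF _ that(3)] by (auto simp: tp_def)
    from fin_sat_extend[OF this fs G_sub]
    obtain p where p: "p \<in> S1 L M (universe M)" "tp L M d B \<union> distinct_from ` universe M \<subseteq> p"
      "finsat_in M p (universe G)" .
    then have "tp L M d B \<subseteq> p" "nonalgebraic M p" using nonalgebraic_iff[OF p(1)] by simp_all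
    then show ?thesis using p(1,3) by blast
  qed
  obtain p where p: "p \<in> S1 L M (universe M)" "tp L M b (insert c (universe G)) \<subseteq> p"
    "nonalgebraic M p" "finsat_in M p (universe G)"
    using extend[OF fs] b c G_sub by blast
  obtain q where q: "q \<in> S1 L M (universe M)" "tp L M c (universe G) \<subseteq> q" "nonalgebraic M q"
    using extend[OF elem_ext_finsat_tp[OF ext]] c G_sub by blast
  \<comment> \<open>With \<open>B\<close> equal to G, \<open>c\<close> itself is the realization
    required by \<open>tensor\<close>; the instance at \<open>c\<close> lies in the type of
    \<open>b\<close> over \<open>Gc\<close>, which \<open>p\<close> extends.\<close>
  have "realizes M c (q \<inter> fml L (universe G) 1)" using S1_extending_tp[OF q(1,2)] c by blast
  moreover have "fsubst (Var(1 := Par c)) product_fm \<in> p"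
    using p(2) product_inst_fml[of c] holds_product_inst bc unfolding tp_def by blast
  ultimately have "product_fm \<in> tensor L \<kappa> M (universe G) p q"
    unfolding tensor_def using G_sub small_G product_fml by blast
  then show ?thesis using p q by blast
qed

lemma coheir_substantial_if_global_types:
  assumes p: "p \<in> S1 L M (universe M)" "nonalgebraic M p" "finsat_in M p (universe G)"
    and q: "q \<in> S1 L M (universe M)" "nonalgebraic M q"
    and "product_fm \<in> tensor L \<kappa> M (universe G) p q"
  shows "coheir_substantial L G M m \<phi>"
proof -
  \<comment> \<open>The definition of \<open>tensor\<close> supplies \<open>c\<close>; since
    \<open>q\<close> is nonalgebraic, \<open>c\<close> avoids \<open>B\<close> and hence G.\<close>
  obtain B c where B: "universe G \<subseteq> B" "B \<subseteq> universe M"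
    and c: "realizes M c (q \<inter> fml L B 1)" and inst: "fsubst (Var(1 := Par c)) product_fm \<in> p"
    using assms(6) unfolding tensor_def by blast
  have cM: "c \<in> universe M" using c by (simp add: realizes_def)
  have c_notin: "c \<notin> universe G" using nonalgebraic_realization_notin[OF q B(2) c] B(1) by blast
  let ?B = "insert c (universe G)"
  have B': "?B \<subseteq> universe M" using cM G_sub by blast
  \<comment> \<open>The global type \<open>p\<close> has no realization, but its restriction to the
    small set \<open>?B\<close> has one by saturation, and that restriction contains the instance at
    \<open>c\<close>.\<close>
  obtain b where b: "realizes M b (p \<inter> fml L ?B 1)"
    using realize[OF S1_restrict[OF p(1) B'] B' small_insert_G] by blast
  have "b \<notin> universe G" using nonalgebraic_realization_notin[OF p(1,2) B' b] by blast
  moreover have "b \<in> universe M" using b by (simp add: realizes_def)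
  moreover have "holds M \<phi> (fun_int M m [b, c])"
    using b inst product_inst_fml holds_product_inst unfolding realizes_def by blast
  moreover have "finsat_in M (tp L M b ?B) (universe G)"
    using S1_restrict_eq_tp[OF p(1) B' b] finsat_in_mono[OF p(3)] by (metis Int_lower1)
  ultimately show ?thesis
    unfolding coheir_substantial_def using cM c_notin by blast
qed

end

theorem theorem3p6:
  fixes L :: "('f, 'r) lang"
    and G M :: "('f, 'r, 'a) fo_struct"
    and H :: "('a, 'b) monoid_scheme"
    and m :: 'f
    and \<kappa> :: "'k rel"
    and \<phi> :: "('f, 'r, 'a) fm"
  assumes "expands_group L G m H"
    and "monster L \<kappa> G M"
    and "\<phi> \<in> fml L (universe G) 1"
  shows "(one_sided_productset H (defset G \<phi>) \<longleftrightarrow> coheir_substantial L G M m \<phi>) \<and>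
    (coheir_substantial L G M m \<phi> \<longleftrightarrow>
      (\<exists>p \<in> S1 L M (universe M). \<exists>q \<in> S1 L M (universe M).
         nonalgebraic M p \<and> nonalgebraic M q \<and> finsat_in M p (universe G) \<and>
         fsubst (Var(0 := App m [Var 0, Var 1])) \<phi> \<in> tensor L \<kappa> M (universe G) p q))"
proof -
  interpret group_monster L G M H m \<kappa> \<phi> using assms by unfold_locales
  show ?thesis
    using coheir_substantial_if_productset productset_if_coheir_substantial
      global_types_if_coheir_substantial coheir_substantial_if_global_types by blast
qed

end
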